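(* Let $X$ be a Tychonoff space, and let $Y$ be a space such that $X\subseteq Y\subseteq \beta X$ (with the subspace topology). Then: (i) if $X$ is Ascoli and $Y\subseteq \mathcal{D} X$, then $Y$ is an Ascoli space; (ii) if $X$ is sequentially Ascoli and $Y\subseteq \upsilon X$, then $Y$ is a sequentially Ascoli space.
   Context: All spaces are assumed to be Tychonoff. $\beta X$, $\upsilon X$ and $\mathcal{D}X$ denote the Stone–Čech compactification, the Hewitt realcompactification and the Dieudonné completion of $X$, respectively, viewed as $X\subseteq \mathcal{D}X\subseteq\upsilon X\subseteq\beta X$; that is, $\upsilon X$ (resp. $\mathcal{D}X$) is the smallest realcompact (resp. Dieudonné complete) subspace of $\beta X$ containing $X$, where a space is Dieudonné complete if it is complete with respect to its finest compatible uniformity. $C_k(X)$ denotes the space $C(X)$ of all continuous real-valued functions on $X$ with the compact-open topology. A subset $H\subseteq C(X)$ is equicontinuous if for every $x\in X$ and each $\varepsilon>0$ there is an open neighborhood $U$ of $x$ such that $|f(x')-f(x)|<\varepsilon$ for all $x'\in U$ and $f\in H$. A Tychonoff space $X$ is Ascoli if every compact subset $\mathcal{K}$ of $C_k(X)$ is evenly continuous, i.e. the map $X\times\mathcal{K}\ni(x,f)\mapsto f(x)$ is continuous (equivalently, every compact subset of $C_k(X)$ is equicontinuous). A Tychonoff space $X$ is sequentially Ascoli if every convergent sequence in $C_k(X)$ is equicontinuous. *)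

theory Defs
  imports "HOL-Analysis.Analysis"
begin

definition Tychonoff_space :: "'a topology \<Rightarrow> bool"
  where "Tychonoff_space X \<longleftrightarrow> completely_regular_space X \<and> Hausdorff_space X"


section \<open>Function spaces and Ascoli spaces\<close>

text \<open>Functions are normalised to be \<^const>\<open>undefined\<close> off the carrier, so that two continuous
  functions on \<open>X\<close> are equal in HOL exactly when they agree on \<open>X\<close>.\<close>

definition cont_real_functions :: "'a topology \<Rightarrow> ('a \<Rightarrow> real) set"
  where "cont_real_functions X = {f \<in> extensional (topspace X). continuous_map X euclideanreal f}"

text \<open>The compact-open topology; \<open>K = {}\<close> shows that its carrier is all of
  \<^term>\<open>cont_real_functions X\<close>.\<close>

definition Ck :: "'a topology \<Rightarrow> ('a \<Rightarrow> real) topology"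
  where "Ck X = topology_generated_by
    {{f \<in> cont_real_functions X. f ` K \<subseteq> U} | K U. compactin X K \<and> open U}"

lemma topspace_Ck: "topspace (Ck X) = cont_real_functions X"
proof -
  have "cont_real_functions X = {f \<in> cont_real_functions X. f ` {} \<subseteq> UNIV}"
    by simp
  then have "cont_real_functions X \<in>
      {{f \<in> cont_real_functions X. f ` K \<subseteq> U} | K U. compactin X K \<and> open U}"
    using compactin_empty open_UNIV by blast
  then show ?thesis
    unfolding Ck_def topology_generated_by_topspace by blast
qed

definition equicontinuous_family :: "'a topology \<Rightarrow> ('a \<Rightarrow> real) set \<Rightarrow> bool"
  where "equicontinuous_family X H \<longleftrightarrow>
    (\<forall>x\<in>topspace X. \<forall>\<epsilon>>0. \<exists>U. openin X U \<and> x \<in> U \<and>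
       (\<forall>x'\<in>U. \<forall>f\<in>H. \<bar>f x' - f x\<bar> < \<epsilon>))"

definition evenly_continuous :: "'a topology \<Rightarrow> ('a \<Rightarrow> real) set \<Rightarrow> bool"
  where "evenly_continuous X K \<longleftrightarrow>
    continuous_map (prod_topology X (subtopology (Ck X) K)) euclideanreal (\<lambda>(x, f). f x)"

definition Ascoli_space :: "'a topology \<Rightarrow> bool"
  where "Ascoli_space X \<longleftrightarrow>
    Tychonoff_space X \<and> (\<forall>K. compactin (Ck X) K \<longrightarrow> evenly_continuous X K)"

definition sequentially_Ascoli_space :: "'a topology \<Rightarrow> bool"
  where "sequentially_Ascoli_space X \<longleftrightarrow>
    Tychonoff_space X \<and>
    (\<forall>f l. range f \<subseteq> topspace (Ck X) \<and> limitin (Ck X) f l sequentially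
       \<longrightarrow> equicontinuous_family X (range f))"


section \<open>Uniformities on a set and Dieudonne completeness\<close>

text \<open>Set-based counterparts of the axioms of the classes \<^class>\<open>uniform_space\<close> and
  \<^class>\<open>open_uniformity\<close>: a uniformity on \<open>S\<close> is a filter of entourages contained in
  \<open>S \<times> S\<close>. In the order of filters, a finer uniformity is a smaller one.\<close>

definition uniformity_on :: "'a set \<Rightarrow> ('a \<times> 'a) filter \<Rightarrow> bool"
  where "uniformity_on S \<U> \<longleftrightarrow>
    \<U> \<le> principal (S \<times> S) \<and>
    (\<forall>E. eventually E \<U> \<longrightarrow>
       (\<forall>x\<in>S. E (x, x)) \<and>
       eventually (\<lambda>(x, y). E (y, x)) \<U> \<and>
       (\<exists>D. eventually D \<U> \<and> (\<forall>x y z. D (x, y) \<longrightarrow> D (y, z) \<longrightarrow> E (x, z))))"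

definition compatible_uniformity :: "'a topology \<Rightarrow> ('a \<times> 'a) filter \<Rightarrow> bool"
  where "compatible_uniformity X \<U> \<longleftrightarrow>
    uniformity_on (topspace X) \<U> \<and>
    (\<forall>W. openin X W \<longleftrightarrow>
       W \<subseteq> topspace X \<and> (\<forall>x\<in>W. eventually (\<lambda>(x', y). x' = x \<longrightarrow> y \<in> W) \<U>))"

definition finest_uniformity :: "'a topology \<Rightarrow> ('a \<times> 'a) filter \<Rightarrow> bool"
  where "finest_uniformity X \<U> \<longleftrightarrow>
    compatible_uniformity X \<U> \<and> (\<forall>\<V>. compatible_uniformity X \<V> \<longrightarrow> \<U> \<le> \<V>)"

definition complete_wrt :: "'a topology \<Rightarrow> ('a \<times> 'a) filter \<Rightarrow> bool"
  where "complete_wrt X \<U> \<longleftrightarrow>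
    (\<forall>F. F \<noteq> bot \<and> F \<le> principal (topspace X) \<and> F \<times>\<^sub>F F \<le> \<U>
       \<longrightarrow> (\<exists>x\<in>topspace X. F \<le> nhdsin X x))"

definition Dieudonne_complete_space :: "'a topology \<Rightarrow> bool"
  where "Dieudonne_complete_space X \<longleftrightarrow>
    Tychonoff_space X \<and> (\<exists>\<U>. finest_uniformity X \<U> \<and> complete_wrt X \<U>)"


section \<open>Realcompactness\<close>

text \<open>Closed subspaces of powers of the real line. Indexing the power by a set of functions
  on \<open>X\<close> is no restriction: coordinates of an embedding that coincide as functions
  on \<open>X\<close> may be identified.\<close>

definition realcompact_space :: "'a topology \<Rightarrow> bool"
  where "realcompact_space X \<longleftrightarrow>
    (\<exists>(I :: ('a \<Rightarrow> real) set) C.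
       closedin (product_topology (\<lambda>_. euclideanreal) I) C \<and>
       X homeomorphic_space subtopology (product_topology (\<lambda>_. euclideanreal) I) C)"


section \<open>The extensions of a Tychonoff space inside its Stone-Cech compactification\<close>

text \<open>\<open>B\<close> is a Stone-Cech compactification of \<open>X\<close> containing \<open>X\<close> as a subspace: the
  (essentially unique) compactification in which \<open>X\<close> is \<open>C\<^sup>*\<close>-embedded.\<close>

definition Stone_Cech_compactification :: "'a topology \<Rightarrow> 'a topology \<Rightarrow> bool"
  where "Stone_Cech_compactification X B \<longleftrightarrow>
    compact_space B \<and> Hausdorff_space B \<and>
    topspace X \<subseteq> topspace B \<and> X = subtopology B (topspace X) \<and>
    B closure_of topspace X = topspace B \<and>
    (\<forall>f. continuous_map X euclideanreal f \<and> bounded (f ` topspace X) \<longrightarrow>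
       (\<exists>g. continuous_map B euclideanreal g \<and> (\<forall>x\<in>topspace X. g x = f x)))"

text \<open>In the following, \<open>B\<close> is meant to be a Stone-Cech compactification of \<open>X\<close>; the
  smallest subspace with the required property is the intersection of all of them.\<close>

definition Dieudonne_completion_in :: "'a topology \<Rightarrow> 'a topology \<Rightarrow> 'a set"
  where "Dieudonne_completion_in B X =
    \<Inter>{Z. topspace X \<subseteq> Z \<and> Z \<subseteq> topspace B \<and> Dieudonne_complete_space (subtopology B Z)}"

definition Hewitt_realcompactification_in :: "'a topology \<Rightarrow> 'a topology \<Rightarrow> 'a set"
  where "Hewitt_realcompactification_in B X =
    \<Inter>{Z. topspace X \<subseteq> Z \<and> Z \<subseteq> topspace B \<and> realcompact_space (subtopology B Z)}"

end

theory Submission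
  imports Defs
begin

text \<open>A compact set (or a convergent sequence) \<open>K\<close> in \<open>C\<^sub>k(Y)\<close> restricts to an equicontinuous family on
  the dense subspace \<open>X\<close>. Let \<open>Z \<subseteq> \<beta>X\<close> consist of the points near which the members of \<open>K\<close>, restricted
  to \<open>X\<close>, have uniformly small oscillation. By density \<open>K\<close> is equicontinuous at every point of \<open>Y \<inter> Z\<close>, so it
  suffices that \<open>Y \<subseteq> Z\<close>. In general \<open>Z\<close> is Dieudonne complete and hence contains the Dieudonne completion.
  If \<open>K\<close> is countable, then any \<open>y \<in> Y - Z\<close> gives a continuous function on \<open>\<beta>X\<close> that is positive
  on \<open>X\<close> but not at \<open>y\<close>, and its cozero set is a realcompact space that contains \<open>X\<close> but not \<open>y\<close>.\<close>

section \<open>Uniformities coarser than a topology\<close>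

text \<open>Encodes a uniformity whose topology is coarser than that of \<open>X\<close>, possibly
  strictly. The uniformity of a single continuous pseudometric belongs to this class, although it is
  rarely compatible.\<close>

definition continuous_uniformity :: "'a topology \<Rightarrow> ('a \<times> 'a) filter \<Rightarrow> bool"
  where "continuous_uniformity X \<U> \<longleftrightarrow> uniformity_on (topspace X) \<U> \<and>
    (\<forall>E. \<forall>x\<in>topspace X. eventually E \<U> \<longrightarrow> (\<exists>U. openin X U \<and> x \<in> U \<and> (\<forall>y\<in>U. E (x, y))))"

lemma uniformity_onD:
  assumes "uniformity_on S \<U>" "eventually E \<U>"
  shows "\<And>x. x \<in> S \<Longrightarrow> E (x, x)"
    and "eventually (\<lambda>(x, y). E (y, x)) \<U>"
    and "\<exists>D. eventually D \<U> \<and> (\<forall>x y z. D (x, y) \<longrightarrow> D (y, z) \<longrightarrow> E (x, z))"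
proof -
  have *: "(\<forall>x\<in>S. E (x, x)) \<and> eventually (\<lambda>(x, y). E (y, x)) \<U> \<and>
       (\<exists>D. eventually D \<U> \<and> (\<forall>x y z. D (x, y) \<longrightarrow> D (y, z) \<longrightarrow> E (x, z)))"
    using assms unfolding uniformity_on_def by (elim conjE allE[of _ E]) (rule mp)
  show "\<And>x. x \<in> S \<Longrightarrow> E (x, x)" using conjunct1[OF *] by (rule bspec)
  show "eventually (\<lambda>(x, y). E (y, x)) \<U>" using conjunct2[OF *] by (rule conjunct1)
  show "\<exists>D. eventually D \<U> \<and> (\<forall>x y z. D (x, y) \<longrightarrow> D (y, z) \<longrightarrow> E (x, z))"
    using conjunct2[OF *] by (rule conjunct2)
qed

text \<open>Compatibility only says which sets are open, and the section of \<open>E\<close> at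
  \<open>x\<close> need not be one of them. The neighbourhood is the uniform interior
  \<open>W\<close> of that section, which is open by the composition axiom.\<close>

lemma compatible_imp_continuous_uniformity:
  assumes "compatible_uniformity X \<U>"
  shows "continuous_uniformity X \<U>"
proof -
  have uni: "uniformity_on (topspace X) \<U>"
    and op: "\<And>W. openin X W \<longleftrightarrow> W \<subseteq> topspace X \<and> (\<forall>x\<in>W. eventually (\<lambda>(x', y). x' = x \<longrightarrow> y \<in> W) \<U>)"
    using assms by (auto simp: compatible_uniformity_def)
  have "\<exists>U. openin X U \<and> x \<in> U \<and> (\<forall>y\<in>U. E (x, y))"
    if x: "x \<in> topspace X" and E: "eventually E \<U>" for E x
  proof -
    define W where "W = {w \<in> topspace X. eventually (\<lambda>(w', y). w' = w \<longrightarrow> E (x, y)) \<U>}"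
    have "eventually (\<lambda>(w', y). w' = w \<longrightarrow> y \<in> W) \<U>" if "w \<in> W" for w
    proof -
      have "eventually (\<lambda>(w', y). w' = w \<longrightarrow> E (x, y)) \<U>"
        using that by (simp add: W_def)
      then obtain D where D: "eventually D \<U>"
          "\<And>a b c. D (a, b) \<Longrightarrow> D (b, c) \<Longrightarrow> a = w \<longrightarrow> E (x, c)"
        using uniformity_onD(3)[OF uni] by fast
      have "eventually (\<lambda>p. p \<in> topspace X \<times> topspace X) \<U>"
        using uni by (simp add: uniformity_on_def le_principal)
      with D(1) have "eventually (\<lambda>p. D p \<and> p \<in> topspace X \<times> topspace X) \<U>"
        by (rule eventually_conj)
      then show ?thesis
      proof (rule eventually_mono, clarify)
        fix y assume y: "D (w, y)" "y \<in> topspace X"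
        have "eventually (\<lambda>(w', z). w' = y \<longrightarrow> E (x, z)) \<U>"
          by (rule eventually_mono[OF D(1)]) (use D(2) y in blast)
        then show "y \<in> W" using y by (simp add: W_def)
      qed
    qed
    then have "openin X W" by (subst op) (auto simp: W_def)
    moreover have "x \<in> W"
    proof -
      have "eventually (\<lambda>(w', y). w' = x \<longrightarrow> E (x, y)) \<U>"
        by (rule eventually_mono[OF E]) auto
      then show ?thesis using x by (simp add: W_def)
    qed
    moreover have "E (x, y)" if "y \<in> W" for y
    proof -
      have "eventually (\<lambda>(w', z). w' = y \<longrightarrow> E (x, z)) \<U>" "y \<in> topspace X"
        using that by (auto simp: W_def)
      then show ?thesis using uniformity_onD(1)[OF uni] by fastforce
    qed
    ultimately show ?thesis by blast
  qed
  with uni show ?thesis by (auto simp: continuous_uniformity_def)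
qed

lemma continuous_uniformityD:
  assumes "continuous_uniformity X \<U>" "eventually E \<U>" "x \<in> topspace X"
  shows "\<exists>U. openin X U \<and> x \<in> U \<and> (\<forall>y\<in>U. E (x, y))"
  using assms unfolding continuous_uniformity_def by meson

text \<open>Builds a uniformity from a base indexed by positive reals, with \<open>comp\<close> in
  the role of the triangle inequality. It serves for pseudometrics and for the oscillation relation,
  which is not given by distances.\<close>

lemma continuous_uniformity_of_scale:
  fixes R :: "real \<Rightarrow> ('a \<times> 'a) set"
  assumes sub: "\<And>\<epsilon>. \<epsilon> > 0 \<Longrightarrow> R \<epsilon> \<subseteq> topspace X \<times> topspace X"
    and sym: "\<And>\<epsilon> x y. \<epsilon> > 0 \<Longrightarrow> (x, y) \<in> R \<epsilon> \<Longrightarrow> (y, x) \<in> R \<epsilon>"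
    and comp: "\<And>\<epsilon> x y z. \<epsilon> > 0 \<Longrightarrow> (x, y) \<in> R (\<epsilon>/2) \<Longrightarrow> (y, z) \<in> R (\<epsilon>/2) \<Longrightarrow> (x, z) \<in> R \<epsilon>"
    and mono: "\<And>\<delta> \<epsilon>. 0 < \<delta> \<Longrightarrow> \<delta> \<le> \<epsilon> \<Longrightarrow> R \<delta> \<subseteq> R \<epsilon>"
    and nbhd: "\<And>\<epsilon> x. \<epsilon> > 0 \<Longrightarrow> x \<in> topspace X \<Longrightarrow>
      \<exists>U. openin X U \<and> x \<in> U \<and> (\<forall>y\<in>U. (x, y) \<in> R \<epsilon>)"
  obtains \<U> where "continuous_uniformity X \<U>" "\<And>\<epsilon>. \<epsilon> > 0 \<Longrightarrow> eventually (\<lambda>p. p \<in> R \<epsilon>) \<U>"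
proof -
  define \<U> where "\<U> = (INF \<epsilon>\<in>{0<..}. principal (R \<epsilon>))"
  have ev: "eventually P \<U> \<longleftrightarrow> (\<exists>\<epsilon>>0. \<forall>p\<in>R \<epsilon>. P p)" for P
    unfolding \<U>_def
  proof (subst eventually_INF_base)
    fix a b :: real assume "a \<in> {0<..}" "b \<in> {0<..}"
    then show "\<exists>c\<in>{0<..}. principal (R c) \<le> inf (principal (R a)) (principal (R b))"
      using mono[of "min a b" a] mono[of "min a b" b]
      by (intro bexI[of _ "min a b"]) auto
  qed (auto simp: eventually_principal)
  have "uniformity_on (topspace X) \<U>"
    unfolding uniformity_on_def
  proof (intro conjI allI impI)
    show "\<U> \<le> principal (topspace X \<times> topspace X)"
      unfolding le_principal ev using sub[of 1] by (intro exI[of _ 1]) auto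
    fix E assume "eventually E \<U>"
    then obtain \<epsilon> where e: "\<epsilon> > 0" "\<And>p. p \<in> R \<epsilon> \<Longrightarrow> E p" by (auto simp: ev)
    \<comment> \<open>Reflexivity comes from \<open>nbhd\<close>, since \<open>x\<close> lies in its
      own neighbourhood.\<close>
    show "\<forall>x\<in>topspace X. E (x, x)" using nbhd e by blast
    show "eventually (\<lambda>(x, y). E (y, x)) \<U>"
      unfolding ev using e sym by blast
    show "\<exists>D. eventually D \<U> \<and> (\<forall>x y z. D (x, y) \<longrightarrow> D (y, z) \<longrightarrow> E (x, z))"
    proof (intro exI conjI)
      show "eventually (\<lambda>p. p \<in> R (\<epsilon>/2)) \<U>" unfolding ev using e by (intro exI[of _ "\<epsilon>/2"]) auto
    qed (use e comp in blast)
  qed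
  moreover have "\<exists>U. openin X U \<and> x \<in> U \<and> (\<forall>y\<in>U. E (x, y))"
    if x: "x \<in> topspace X" and E: "eventually E \<U>" for E x
    using E nbhd[OF _ x] unfolding ev by meson
  ultimately show thesis
    using that[of \<U>] by (auto simp: continuous_uniformity_def ev)
qed

text \<open>Gives the directedness by which an entourage of the infimum of all continuous
  uniformities already belongs to one of them.\<close>

lemma continuous_uniformity_inf:
  assumes "continuous_uniformity X \<U>" "continuous_uniformity X \<V>"
  shows "continuous_uniformity X (inf \<U> \<V>)"
proof -
  have U: "uniformity_on (topspace X) \<U>" and V: "uniformity_on (topspace X) \<V>"
    using assms by (auto simp: continuous_uniformity_def)
  have "uniformity_on (topspace X) (inf \<U> \<V>)"
    unfolding uniformity_on_def
  proof (intro conjI allI impI)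
    show "inf \<U> \<V> \<le> principal (topspace X \<times> topspace X)"
      using U by (auto simp: uniformity_on_def intro: le_infI1)
    fix E assume "eventually E (inf \<U> \<V>)"
    then obtain P Q where PQ: "eventually P \<U>" "eventually Q \<V>" "\<And>p. P p \<Longrightarrow> Q p \<Longrightarrow> E p"
      by (auto simp: eventually_inf)
    show "\<forall>x\<in>topspace X. E (x, x)" using uniformity_onD(1)[OF U PQ(1)] uniformity_onD(1)[OF V PQ(2)] PQ(3) by blast
    have "eventually (\<lambda>(x, y). P (y, x)) \<U>" "eventually (\<lambda>(x, y). Q (y, x)) \<V>"
      using uniformity_onD(2)[OF U PQ(1)] uniformity_onD(2)[OF V PQ(2)] by auto
    then show "eventually (\<lambda>(x, y). E (y, x)) (inf \<U> \<V>)"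
      unfolding eventually_inf using PQ(3) by fast
    obtain D1 D2 where D: "eventually D1 \<U>" "eventually D2 \<V>"
      "\<And>x y z. D1 (x, y) \<Longrightarrow> D1 (y, z) \<Longrightarrow> P (x, z)"
      "\<And>x y z. D2 (x, y) \<Longrightarrow> D2 (y, z) \<Longrightarrow> Q (x, z)"
      using uniformity_onD(3)[OF U PQ(1)] uniformity_onD(3)[OF V PQ(2)] by blast
    then show "\<exists>D. eventually D (inf \<U> \<V>) \<and> (\<forall>x y z. D (x, y) \<longrightarrow> D (y, z) \<longrightarrow> E (x, z))"
      using PQ(3) by (intro exI[of _ "\<lambda>p. D1 p \<and> D2 p"]) (auto simp: eventually_inf)
  qed
  moreover have "\<exists>U. openin X U \<and> x \<in> U \<and> (\<forall>y\<in>U. E (x, y))"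
    if x: "x \<in> topspace X" and E: "eventually E (inf \<U> \<V>)" for E x
  proof -
    obtain P Q where PQ: "eventually P \<U>" "eventually Q \<V>" "\<And>p. P p \<Longrightarrow> Q p \<Longrightarrow> E p"
      using E by (auto simp: eventually_inf)
    obtain U1 U2 where "openin X U1" "x \<in> U1" "\<forall>y\<in>U1. P (x, y)"
      "openin X U2" "x \<in> U2" "\<forall>y\<in>U2. Q (x, y)"
      using continuous_uniformityD[OF assms(1) PQ(1) x] continuous_uniformityD[OF assms(2) PQ(2) x]
      by blast
    then show ?thesis using PQ(3) by (intro exI[of _ "U1 \<inter> U2"]) auto
  qed
  ultimately show ?thesis by (auto simp: continuous_uniformity_def)
qed

text \<open>The finest uniformity is the infimum of all continuous ones; complete regularity makes
  its topology as fine as that of \<open>X\<close>. The second conclusion extends minimality to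
  continuous uniformities that are not compatible.\<close>

lemma completely_regular_imp_finest_uniformity:
  assumes "completely_regular_space X"
  obtains \<U> where "finest_uniformity X \<U>" "\<And>\<V>. continuous_uniformity X \<V> \<Longrightarrow> \<U> \<le> \<V>"
proof -
  define \<U> where "\<U> = Inf {\<V>. continuous_uniformity X \<V>}"
  have le: "\<U> \<le> \<V>" if "continuous_uniformity X \<V>" for \<V>
    unfolding \<U>_def using that by (simp add: Inf_lower)
  \<comment> \<open>The indiscrete uniformity shows that the family is nonempty.\<close>
  obtain \<V>0 where V0: "continuous_uniformity X \<V>0"
    using continuous_uniformity_of_scale[of "\<lambda>_. topspace X \<times> topspace X" X] by blast
  have ev: "eventually P \<U> \<longleftrightarrow> (\<exists>\<V>. continuous_uniformity X \<V> \<and> eventually P \<V>)" for P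
    unfolding \<U>_def
  proof (subst eventually_Inf_base)
    fix F G assume "F \<in> {\<V>. continuous_uniformity X \<V>}" "G \<in> {\<V>. continuous_uniformity X \<V>}"
    then show "\<exists>x\<in>{\<V>. continuous_uniformity X \<V>}. x \<le> inf F G"
      by (intro bexI[of _ "inf F G"]) (auto intro: continuous_uniformity_inf)
  qed (use V0 in auto)
  have "uniformity_on (topspace X) \<U>"
    unfolding uniformity_on_def
  proof (intro conjI allI impI)
    show "\<U> \<le> principal (topspace X \<times> topspace X)"
      using le[OF V0] V0 by (auto simp: continuous_uniformity_def uniformity_on_def)
    fix E assume "eventually E \<U>"
    then obtain \<V> where V: "continuous_uniformity X \<V>" "eventually E \<V>" by (auto simp: ev)
    then have u: "uniformity_on (topspace X) \<V>" by (simp add: continuous_uniformity_def)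
    show "\<forall>x\<in>topspace X. E (x, x)" using uniformity_onD(1)[OF u V(2)] by blast
    have "eventually (\<lambda>(x, y). E (y, x)) \<V>" by (rule uniformity_onD(2)[OF u V(2)])
    then show "eventually (\<lambda>(x, y). E (y, x)) \<U>" using V(1) ev by blast
    obtain D where "eventually D \<V>" "\<And>x y z. D (x, y) \<Longrightarrow> D (y, z) \<Longrightarrow> E (x, z)"
      using uniformity_onD(3)[OF u V(2)] by blast
    then show "\<exists>D. eventually D \<U> \<and> (\<forall>x y z. D (x, y) \<longrightarrow> D (y, z) \<longrightarrow> E (x, z))"
      using ev V(1) by blast
  qed
  moreover have "openin X W \<longleftrightarrow>
      W \<subseteq> topspace X \<and> (\<forall>x\<in>W. eventually (\<lambda>(x', y). x' = x \<longrightarrow> y \<in> W) \<U>)" (is "_ \<longleftrightarrow> ?R") for W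
  proof
    assume W: "openin X W"
    have "eventually (\<lambda>(x', y). x' = x \<longrightarrow> y \<in> W) \<U>" if x: "x \<in> W" for x
    proof -
      obtain f where f: "continuous_map X euclideanreal f" "f x = 0" "f ` (topspace X - W) \<subseteq> {1}"
        using assms W x unfolding completely_regular_space_alt' by blast
      \<comment> \<open>Entourages of a pseudometric: since \<open>f x = 0\<close> and
        \<open>f = 1\<close> off \<open>W\<close>, scale 1 confines the points close to
        \<open>x\<close> to \<open>W\<close>.\<close>
      let ?R = "\<lambda>\<epsilon>. {(a, b) \<in> topspace X \<times> topspace X. \<bar>f a - f b\<bar> < \<epsilon>}"
      obtain \<V> where V: "continuous_uniformity X \<V>" "eventually (\<lambda>p. p \<in> ?R 1) \<V>"
      proof (rule continuous_uniformity_of_scale[of ?R X])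
        fix \<epsilon> :: real and a assume a: "\<epsilon> > 0" "a \<in> topspace X"
        have "openin X {b \<in> topspace X. f b \<in> ball (f a) \<epsilon>}"
          using f(1) by (rule openin_continuous_map_preimage) auto
        then show "\<exists>U. openin X U \<and> a \<in> U \<and> (\<forall>b\<in>U. (a, b) \<in> ?R \<epsilon>)"
          using a by (intro exI[of _ "{b \<in> topspace X. f b \<in> ball (f a) \<epsilon>}"])
            (auto simp: dist_real_def)
      next
        fix \<epsilon> :: real and a b c
        assume "(a, b) \<in> ?R (\<epsilon>/2)" "(b, c) \<in> ?R (\<epsilon>/2)"
        then show "(a, c) \<in> ?R \<epsilon>" by (auto simp: abs_if split: if_splits)
      qed (auto simp: abs_minus_commute)
      have "eventually (\<lambda>(x', y). x' = x \<longrightarrow> y \<in> W) \<V>"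
        by (rule eventually_mono[OF V(2)]) (use f in force)
      with V(1) ev show ?thesis by blast
    qed
    then show ?R using W openin_subset by blast
  next
    assume R: ?R
    show "openin X W"
    proof (subst openin_subopen, intro ballI)
      fix x assume x: "x \<in> W"
      have "eventually (\<lambda>(x', y). x' = x \<longrightarrow> y \<in> W) \<U>" "x \<in> topspace X" using R x by auto
      then obtain \<V> where \<V>: "continuous_uniformity X \<V>"
          "eventually (\<lambda>(x', y). x' = x \<longrightarrow> y \<in> W) \<V>"
        unfolding ev by (elim exE conjE)
      obtain U where "openin X U" "x \<in> U"
          "\<forall>y\<in>U. case (x, y) of (x', y) \<Rightarrow> x' = x \<longrightarrow> y \<in> W"
        using continuous_uniformityD[OF \<V> \<open>x \<in> topspace X\<close>] by (elim exE conjE)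
      then show "\<exists>T. openin X T \<and> x \<in> T \<and> T \<subseteq> W" by auto
    qed
  qed
  ultimately have "compatible_uniformity X \<U>" by (simp add: compatible_uniformity_def)
  then have "finest_uniformity X \<U>"
    using le compatible_imp_continuous_uniformity by (auto simp: finest_uniformity_def)
  with le that show thesis by blast
qed

section \<open>Cluster points and convergence of Cauchy filters\<close>

lemma Cauchy_filter_le_nhdsin:
  assumes U: "compatible_uniformity X \<U>" and x: "x \<in> topspace X" and F: "F \<times>\<^sub>F F \<le> \<U>"
    and clust: "\<And>W. openin X W \<Longrightarrow> x \<in> W \<Longrightarrow> frequently (\<lambda>y. y \<in> W) F"
  shows "F \<le> nhdsin X x"
proof (rule filter_leI)
  fix P assume P: "eventually P (nhdsin X x)"
  show "eventually P F"
  proof -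
    obtain W where W: "openin X W" "x \<in> W" "\<And>y. y \<in> W \<Longrightarrow> P y"
      using P x by (auto simp: eventually_nhdsin)
    have uni: "uniformity_on (topspace X) \<U>"
      using U by (simp add: compatible_uniformity_def)
    have "eventually (\<lambda>(x', y). x' = x \<longrightarrow> y \<in> W) \<U>"
      using U W by (simp add: compatible_uniformity_def)
    then obtain D where D: "eventually D \<U>"
        "\<And>a b c. D (a, b) \<Longrightarrow> D (b, c) \<Longrightarrow> a = x \<longrightarrow> c \<in> W"
      using uniformity_onD(3)[OF uni] by fast
    obtain V where V: "openin X V" "x \<in> V" "\<forall>y\<in>V. D (x, y)"
      using continuous_uniformityD[OF compatible_imp_continuous_uniformity[OF U] D(1) x]
      by (elim exE conjE)
    have "eventually D (F \<times>\<^sub>F F)" using F D(1) by (auto simp: le_filter_def)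
    then obtain Q where Q: "eventually Q F" "\<And>a b. Q a \<Longrightarrow> Q b \<Longrightarrow> D (a, b)"
      by (auto simp: eventually_prod_same)
    \<comment> \<open>The cluster property yields a point \<open>a\<close> of the
      \<open>D\<close>-small member inside \<open>V\<close>; composing \<open>D (x, a)\<close> with
      \<open>D (a, y)\<close> then places the whole member in \<open>W\<close>.\<close>
    have "frequently (\<lambda>y. y \<in> V \<and> Q y) F"
      using clust[OF V(1,2)] Q(1) by (simp add: frequently_eventually_frequently)
    then obtain a where "a \<in> V" "Q a" by (auto dest: frequently_ex)
    then show ?thesis using Q D(2) V(3) W(3) by (intro eventually_mono[OF Q(1)]) blast
  qed
qed

text \<open>Otherwise each point has a neighbourhood that the filter eventually avoids; finitely
  many of them cover \<open>B\<close>, so the filter would avoid all of \<open>B\<close>.\<close>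

lemma compact_space_imp_cluster_point:
  assumes "compact_space B" "F \<noteq> bot" "F \<le> principal (topspace B)"
  obtains b where "b \<in> topspace B" "\<And>W. openin B W \<Longrightarrow> b \<in> W \<Longrightarrow> frequently (\<lambda>x. x \<in> W) F"
proof (rule ccontr)
  assume "\<not> thesis"
  then have "\<forall>b\<in>topspace B. \<exists>W. openin B W \<and> b \<in> W \<and> \<not> frequently (\<lambda>x. x \<in> W) F"
    using that by blast
  then obtain W where W: "\<And>b. b \<in> topspace B \<Longrightarrow> openin B (W b) \<and> b \<in> W b \<and> eventually (\<lambda>x. x \<notin> W b) F"
    unfolding not_frequently by metis
  have "compactin B (topspace B)" using assms(1) by (simp add: compact_space_def)
  moreover have "\<forall>U\<in>W ` topspace B. openin B U" "topspace B \<subseteq> \<Union>(W ` topspace B)"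
    using W by blast+
  ultimately obtain \<F> where \<F>: "finite \<F>" "\<F> \<subseteq> W ` topspace B" "topspace B \<subseteq> \<Union>\<F>"
    unfolding compactin_def by meson
  have "eventually (\<lambda>x. \<forall>V\<in>\<F>. x \<notin> V) F"
    using \<F> W by (subst eventually_ball_finite_distrib) auto
  moreover have "eventually (\<lambda>x. x \<in> topspace B) F" using assms(3) by (simp add: le_principal)
  ultimately have "eventually (\<lambda>_. False) F"
    by eventually_elim (use \<F> in blast)
  with assms(2) show False by (simp add: eventually_False)
qed


section \<open>Real functions on dense subspaces\<close>

lemma continuous_map_real_iff: "continuous_map X euclideanreal f \<longleftrightarrow>
    (\<forall>x\<in>topspace X. \<forall>\<epsilon>>0. \<exists>U. openin X U \<and> x \<in> U \<and> (\<forall>y\<in>U. \<bar>f y - f x\<bar> < \<epsilon>))"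
proof -
  have "f y \<in> Met_TC.mball (f x) \<epsilon> \<longleftrightarrow> \<bar>f y - f x\<bar> < \<epsilon>" for x y \<epsilon>
    unfolding mball_eq_ball mem_ball dist_real_def by (subst abs_minus_commute) (rule refl)
  then show ?thesis
    using Met_TC.continuous_map_to_metric[of X f] by (simp only: mtopology_is_euclidean)
qed

lemma continuous_map_real_openin:
  assumes "continuous_map X euclideanreal f"
  shows "openin X {x \<in> topspace X. f x < c}" "openin X {x \<in> topspace X. f x > c}"
  using openin_continuous_map_preimage[OF assms, of "{..<c}"]
    openin_continuous_map_preimage[OF assms, of "{c<..}"] by simp_all

text \<open>Carries bounds known on the dense set over to limit points: the part of \<open>U\<close>
  where \<open>f > c\<close> is open, so if it were nonempty it would meet \<open>S\<close>.\<close>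

lemma dense_le_on_open:
  assumes f: "continuous_map T euclideanreal f"
    and dense: "T closure_of S = topspace T"
    and U: "openin T U" "y \<in> U" and le: "\<And>x. x \<in> U \<inter> S \<Longrightarrow> f x \<le> c"
  shows "f y \<le> c"
proof (rule ccontr)
  assume "\<not> f y \<le> c"
  then have "y \<in> U \<inter> {x \<in> topspace T. f x > c}" using U openin_subset by fastforce
  moreover have "openin T (U \<inter> {x \<in> topspace T. f x > c})"
    using U(1) continuous_map_real_openin(2)[OF f] by blast
  ultimately obtain x where "x \<in> S" "x \<in> U \<inter> {x \<in> topspace T. f x > c}"
    using dense unfolding dense_intersects_open by blast
  then show False using le[of x] by auto
qed

section \<open>Equicontinuous families and their truncated distance functions\<close>

lemma equicontinuous_familyD:
  assumes "equicontinuous_family X K" "x \<in> topspace X" "\<epsilon> > 0"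
  shows "\<exists>U. openin X U \<and> x \<in> U \<and> (\<forall>y\<in>U. \<forall>f\<in>K. \<bar>f y - f x\<bar> < \<epsilon>)"
proof -
  have "\<forall>\<epsilon>>0. \<exists>U. openin X U \<and> x \<in> U \<and> (\<forall>y\<in>U. \<forall>f\<in>K. \<bar>f y - f x\<bar> < \<epsilon>)"
    using assms(1) unfolding equicontinuous_family_def by (rule bspec) (rule assms(2))
  then show ?thesis using assms(3) by simp
qed

text \<open>Each term is 1-Lipschitz in the value of \<open>f\<close>, so the common modulus given
  by equicontinuity survives the supremum. Truncation at 1 keeps the supremum finite.\<close>

lemma continuous_map_SUP_truncated_distance:
  assumes K: "equicontinuous_family X K" "K \<noteq> {}" and w: "\<And>f. f \<in> K \<Longrightarrow> 0 \<le> w f \<and> w f \<le> (1::real)"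
  shows "continuous_map X euclideanreal (\<lambda>x. SUP f\<in>K. w f * min 1 \<bar>f x - c f\<bar>)"
  unfolding continuous_map_real_iff
proof (intro ballI allI impI)
  let ?g = "\<lambda>x. SUP f\<in>K. w f * min 1 \<bar>f x - c f\<bar>"
  fix x and \<epsilon> :: real assume x: "x \<in> topspace X" and "\<epsilon> > 0"
  then obtain U where U: "openin X U" "x \<in> U" "\<forall>y\<in>U. \<forall>f\<in>K. \<bar>f y - f x\<bar> < \<epsilon>/2"
    using equicontinuous_familyD[OF K(1) x, of "\<epsilon>/2"] by auto
  have bdd: "bdd_above ((\<lambda>f. w f * min 1 \<bar>f z - c f\<bar>) ` K)" for z
    by (rule bdd_aboveI2[of _ _ 1]) (use w in \<open>auto intro!: mult_le_one\<close>)
  \<comment> \<open>The supremum weakens \<open><\<close> to \<open>\<le>\<close>; the bound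
    \<open>\<epsilon>/2\<close> leaves room for strictness at the end.\<close>
  have le: "?g y \<le> ?g z + \<epsilon>/2" if d: "\<And>f. f \<in> K \<Longrightarrow> \<bar>f y - f z\<bar> < \<epsilon>/2" for y z
  proof (rule cSUP_least[OF K(2)])
    fix f assume f: "f \<in> K"
    have "w f * (min 1 \<bar>f y - c f\<bar> - min 1 \<bar>f z - c f\<bar>) \<le> w f * (\<epsilon>/2)"
      using d[OF f] w[OF f] by (intro mult_left_mono) (auto simp: min_def abs_if split: if_splits)
    also have "\<dots> \<le> \<epsilon>/2" using w[OF f] \<open>\<epsilon> > 0\<close> by (simp add: mult_left_le_one_le)
    finally have "w f * min 1 \<bar>f y - c f\<bar> \<le> w f * min 1 \<bar>f z - c f\<bar> + \<epsilon>/2"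
      by (simp add: algebra_simps)
    also have "w f * min 1 \<bar>f z - c f\<bar> \<le> ?g z" by (rule cSUP_upper[OF f bdd])
    finally show "w f * min 1 \<bar>f y - c f\<bar> \<le> ?g z + \<epsilon>/2" by simp
  qed
  have "\<bar>?g y - ?g x\<bar> < \<epsilon>" if "y \<in> U" for y
    using le[of y x] le[of x y] U(3) that \<open>\<epsilon> > 0\<close> by (auto simp: abs_minus_commute)
  then show "\<exists>U. openin X U \<and> x \<in> U \<and> (\<forall>y\<in>U. \<bar>?g y - ?g x\<bar> < \<epsilon>)" using U by blast
qed

lemma SUP_truncated_distance:
  assumes "K \<noteq> {}" and w: "\<And>f. f \<in> K \<Longrightarrow> 0 \<le> w f \<and> w f \<le> (1::real)"
  shows "\<And>f. f \<in> K \<Longrightarrow> w f * min 1 \<bar>f x - c f\<bar> \<le> (SUP f\<in>K. w f * min 1 \<bar>f x - c f\<bar>)"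
    and "0 \<le> (SUP f\<in>K. w f * min 1 \<bar>f x - c f\<bar>)"
    and "(SUP f\<in>K. w f * min 1 \<bar>f x - c f\<bar>) \<le> 1"
proof -
  have bdd: "bdd_above ((\<lambda>f. w f * min 1 \<bar>f x - c f\<bar>) ` K)"
    by (rule bdd_aboveI2[of _ _ 1]) (use w in \<open>auto intro!: mult_le_one\<close>)
  show up: "w f * min 1 \<bar>f x - c f\<bar> \<le> (SUP f\<in>K. w f * min 1 \<bar>f x - c f\<bar>)" if "f \<in> K" for f
    by (rule cSUP_upper[OF that bdd])
  obtain f where "f \<in> K" using assms(1) by blast
  then show "0 \<le> (SUP f\<in>K. w f * min 1 \<bar>f x - c f\<bar>)"
    using w[of f] by (intro order_trans[OF _ up[of f]]) auto
  show "(SUP f\<in>K. w f * min 1 \<bar>f x - c f\<bar>) \<le> 1"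
    by (rule cSUP_least[OF assms(1)]) (use w in \<open>auto intro!: mult_le_one\<close>)
qed

text \<open>Condenses the distance of all of \<open>K\<close> from prescribed values
  \<open>c f\<close> into one bounded continuous function, to which the extension property of
  \<open>B\<close> applies. Constant weight 1 detects uniform closeness, weights tending to 0 only
  closeness for each \<open>f\<close> separately.\<close>

lemma Stone_Cech_extension_SUP_truncated_distance:
  assumes SC: "Stone_Cech_compactification X B" and K: "equicontinuous_family X K" "K \<noteq> {}"
    and w: "\<And>f. f \<in> K \<Longrightarrow> 0 \<le> w f \<and> w f \<le> (1::real)"
  shows "\<exists>g. continuous_map B euclideanreal g \<and>
    (\<forall>x\<in>topspace X. g x = (SUP f\<in>K. w f * min 1 \<bar>f x - c f\<bar>))"
proof -
  let ?g = "\<lambda>x. SUP f\<in>K. w f * min 1 \<bar>f x - c f\<bar>"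
  have "bounded (?g ` topspace X)"
    by (rule boundedI[of _ 1]) (use SUP_truncated_distance(2,3)[where w = w, OF K(2) w, where c = c] in auto)
  with continuous_map_SUP_truncated_distance[where w = w, OF K w, where c = c]
  show ?thesis
    using SC unfolding Stone_Cech_compactification_def by (elim conjE allE[of _ ?g]) (rule mp, simp_all)
qed


section \<open>Points of small oscillation\<close>

text \<open>Only values on \<open>S\<close> enter, so the condition also applies at points of
  \<open>B\<close> where the members of \<open>K\<close> have no prescribed values.\<close>

definition small_oscillation_points :: "'a topology \<Rightarrow> 'a set \<Rightarrow> ('a \<Rightarrow> real) set \<Rightarrow> 'a set"
  where "small_oscillation_points B S K = {z \<in> topspace B. \<forall>\<epsilon>>0. \<exists>U. openin B U \<and> z \<in> U \<and>
    (\<forall>f\<in>K. \<forall>x\<in>U \<inter> S. \<forall>x'\<in>U \<inter> S. \<bar>f x - f x'\<bar> < \<epsilon>)}"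

lemma small_oscillation_pointsD:
  assumes "z \<in> small_oscillation_points B S K" "\<epsilon> > 0"
  shows "\<exists>U. openin B U \<and> z \<in> U \<and> (\<forall>f\<in>K. \<forall>x\<in>U \<inter> S. \<forall>x'\<in>U \<inter> S. \<bar>f x - f x'\<bar> < \<epsilon>)"
proof -
  have "\<forall>\<epsilon>>0. \<exists>U. openin B U \<and> z \<in> U \<and>
      (\<forall>f\<in>K. \<forall>x\<in>U \<inter> S. \<forall>x'\<in>U \<inter> S. \<bar>f x - f x'\<bar> < \<epsilon>)"
    using assms(1) unfolding small_oscillation_points_def mem_Collect_eq by (rule conjunct2)
  then show ?thesis using assms(2) by (elim allE impE)
qed

text \<open>Closeness to reference values \<open>c f\<close> is what the extended distance functions
  deliver; two such estimates bound the oscillation. Scales up to 1 suffice, matching the truncation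
  at 1.\<close>

lemma small_oscillation_pointsI:
  assumes "z \<in> topspace B"
    and *: "\<And>\<delta>. 0 < \<delta> \<Longrightarrow> \<delta> \<le> 1 \<Longrightarrow>
      \<exists>c U. openin B U \<and> z \<in> U \<and> (\<forall>f\<in>K. \<forall>x\<in>U \<inter> S. \<bar>f x - c f\<bar> < \<delta>)"
  shows "z \<in> small_oscillation_points B S K"
  unfolding small_oscillation_points_def
proof (intro CollectI conjI allI impI assms(1))
  fix \<epsilon> :: real assume "\<epsilon> > 0"
  then have "(0::real) < min 1 (\<epsilon>/2)" "min 1 (\<epsilon>/2) \<le> 1" by auto
  from *[OF this] obtain c U where U: "openin B U" "z \<in> U"
      "\<forall>f\<in>K. \<forall>x\<in>U \<inter> S. \<bar>f x - c f\<bar> < min 1 (\<epsilon>/2)"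
    by (elim exE conjE)
  have "\<bar>f x - f x'\<bar> < \<epsilon>" if "f \<in> K" "x \<in> U \<inter> S" "x' \<in> U \<inter> S" for f x x'
    using U(3)[rule_format, OF that(1,2)] U(3)[rule_format, OF that(1,3)] by linarith
  then have "\<forall>f\<in>K. \<forall>x\<in>U \<inter> S. \<forall>x'\<in>U \<inter> S. \<bar>f x - f x'\<bar> < \<epsilon>" by (intro ballI)
  with U(1,2) show "\<exists>U. openin B U \<and> z \<in> U \<and> (\<forall>f\<in>K. \<forall>x\<in>U \<inter> S. \<forall>x'\<in>U \<inter> S. \<bar>f x - f x'\<bar> < \<epsilon>)"
    by (intro exI[of _ U] conjI)
qed

text \<open>Compare all values with those at one point \<open>x0\<close> of \<open>S\<close> near
  \<open>y\<close>: the bound by \<open>\<epsilon>/3\<close> holds on \<open>S\<close>, hence by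
  continuity and density on the whole neighbourhood, \<open>y\<close> included.\<close>

lemma small_oscillation_imp_equicontinuous:
  assumes K: "\<And>f. f \<in> K \<Longrightarrow> continuous_map (subtopology B Y) euclideanreal f"
    and dense: "subtopology B Y closure_of S = topspace (subtopology B Y)"
    and osc: "topspace (subtopology B Y) \<subseteq> small_oscillation_points B S K"
  shows "equicontinuous_family (subtopology B Y) K"
  unfolding equicontinuous_family_def
proof (intro ballI allI impI)
  let ?T = "subtopology B Y"
  fix y and \<epsilon> :: real assume y: "y \<in> topspace ?T" and "\<epsilon> > 0"
  then have "y \<in> small_oscillation_points B S K" "\<epsilon>/3 > 0" using osc by auto
  then obtain U where U: "openin B U" "y \<in> U"
      "\<forall>f\<in>K. \<forall>x\<in>U \<inter> S. \<forall>x'\<in>U \<inter> S. \<bar>f x - f x'\<bar> < \<epsilon>/3"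
    using small_oscillation_pointsD[of y B S K "\<epsilon>/3"] by auto
  have V: "openin ?T (U \<inter> Y)" "y \<in> U \<inter> Y" using U y by (auto simp: openin_subtopology)
  then obtain x0 where x0: "x0 \<in> S" "x0 \<in> U \<inter> Y"
    using dense unfolding dense_intersects_open by blast
  have le: "\<bar>f y' - f x0\<bar> \<le> \<epsilon>/3" if "f \<in> K" "y' \<in> U \<inter> Y" for f y'
  proof (rule dense_le_on_open[OF _ dense V(1) that(2)])
    show "continuous_map ?T euclideanreal (\<lambda>y. \<bar>f y - f x0\<bar>)"
      using K[OF that(1)] by (intro continuous_intros) auto
    show "\<bar>f x - f x0\<bar> \<le> \<epsilon>/3" if "x \<in> U \<inter> Y \<inter> S" for x
      using U(3)[rule_format, OF \<open>f \<in> K\<close>, of x x0] that x0 by auto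
  qed
  have "\<bar>f y' - f y\<bar> < \<epsilon>" if "f \<in> K" "y' \<in> U \<inter> Y" for f y'
    using le[OF that] le[OF that(1) V(2)] \<open>\<epsilon> > 0\<close> by linarith
  with V show "\<exists>U. openin ?T U \<and> y \<in> U \<and> (\<forall>x'\<in>U. \<forall>f\<in>K. \<bar>f x' - f y\<bar> < \<epsilon>)" by blast
qed


section \<open>Points of the Hewitt realcompactification\<close>

text \<open>Adjoining the coordinate \<open>1/q\<close> makes the canonical map into the power of the real line
  closed, because a bound on \<open>1/q\<close> confines the points to a compact subset of the cozero set.\<close>

lemma realcompact_space_cozero:
  assumes B: "compact_space B" "Hausdorff_space B" and q: "continuous_map B euclideanreal q"
  shows "realcompact_space (subtopology B {b \<in> topspace B. q b > 0})"
proof -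
  define Z where "Z = {b \<in> topspace B. q b > 0}"
  let ?T = "subtopology B Z"
  define I where "I = {g. continuous_map ?T euclideanreal g}"
  let ?P = "product_topology (\<lambda>_. euclideanreal) I"
  define e where "e = (\<lambda>z. \<lambda>g\<in>I. g z)"
  have topT: "topspace ?T = Z" by (auto simp: Z_def)
  have cont: "continuous_map ?T ?P e"
    unfolding continuous_map_componentwise by (auto simp: e_def I_def)
  have haus: "Hausdorff_space ?P"
    by (simp add: Hausdorff_space_product_topology)
  have qT: "continuous_map ?T euclideanreal q" using q by (rule continuous_map_from_subtopology)
  have r: "(\<lambda>z. 1 / q z) \<in> I"
    unfolding I_def using qT by (intro CollectI continuous_map_real_divide) (auto simp: Z_def)
  have "closed_map ?T ?P e"
    unfolding closed_map_def
  proof (intro allI impI)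
    fix A assume "closedin ?T A"
    then obtain A' where A': "closedin B A'" "A = A' \<inter> Z"
      by (auto simp: closedin_subtopology)
    show "closedin ?P (e ` A)"
    proof -
      have "p \<in> e ` A" if p: "p \<in> ?P closure_of (e ` A)" for p
      proof -
        \<comment> \<open>Since \<open>t\<close> exceeds the coordinate \<open>1/q\<close> of
          \<open>p\<close>, points of \<open>A\<close> with images near \<open>p\<close> satisfy
          \<open>t * q > 1\<close>. The closed conditions \<open>t * q \<ge> 1\<close> and
          \<open>q \<ge> 0\<close> together force \<open>q > 0\<close>, so \<open>C\<close> is a
          compact part of \<open>A\<close>.\<close>
        define t where "t = p (\<lambda>z. 1 / q z) + 1"
        define C where "C = A' \<inter> {b \<in> topspace B. q b \<in> {0..}} \<inter> {b \<in> topspace B. t * q b \<in> {1..}}"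
        have "closedin B C"
          unfolding C_def
          by (intro closedin_Int A' closedin_continuous_map_preimage[of B euclideanreal]
              continuous_intros q) auto
        then have compB: "compactin B C" using B closedin_compact_space by blast
        have CA: "C \<subseteq> A"
        proof
          fix b assume b: "b \<in> C"
          then have "q b \<noteq> 0" by (auto simp: C_def)
          with b show "b \<in> A" by (auto simp: C_def A' Z_def)
        qed
        then have "compactin ?T C" using compB A' by (auto simp: compactin_subtopology)
        then have "compactin ?P (e ` C)" using cont image_compactin by blast
        then have clo: "closedin ?P (e ` C)" using haus compactin_imp_closedin by blast
        have tp: "p \<in> topspace ?P" using p by (meson in_closure_of)
        let ?V = "{v \<in> topspace ?P. v (\<lambda>z. 1 / q z) < t}"
        have oV: "openin ?P ?V"
          using continuous_map_product_projection[OF r, of "\<lambda>_. euclideanreal"]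
          by (rule continuous_map_real_openin)
        have "p \<in> ?P closure_of (e ` C)"
          unfolding in_closure_of
        proof (intro conjI allI impI tp)
          fix W assume W: "p \<in> W \<and> openin ?P W"
          have "p \<in> W \<inter> ?V" "openin ?P (W \<inter> ?V)" using W oV tp by (auto simp: t_def)
          then obtain v where v: "v \<in> e ` A" "v \<in> W \<inter> ?V"
            using p unfolding in_closure_of by meson
          then obtain a where a: "a \<in> A" "v = e a" by blast
          have qa: "q a > 0" "a \<in> topspace B" "a \<in> A'" using a A' by (auto simp: Z_def)
          have "1 / q a < t" using v a r by (auto simp: e_def)
          then have "t * q a > 1" using qa by (simp add: field_simps)
          then have "a \<in> C" using qa by (auto simp: C_def)
          then show "\<exists>y. y \<in> e ` C \<and> y \<in> W" using v a by blast
        qed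
        then show ?thesis using clo CA by (auto simp: closure_of_closedin)
      qed
      moreover have "e ` A \<subseteq> topspace ?P"
        using cont A' topT unfolding continuous_map_def by auto
      ultimately show ?thesis
        by (meson closure_of_subset_eq subsetI)
    qed
  qed
  moreover have "inj_on e (topspace ?T)"
  proof (rule inj_onI, rule ccontr)
    fix x y assume xy: "x \<in> topspace ?T" "y \<in> topspace ?T" "e x = e y" "x \<noteq> y"
    have "completely_regular_space ?T"
      using B by (simp add: completely_regular_space_subtopology normal_imp_completely_regular_space
          compact_Hausdorff_or_regular_imp_normal_space)
    moreover have "closedin ?T {y}"
      using B xy by (simp add: Hausdorff_space_subtopology closedin_Hausdorff_sing_eq)
    ultimately obtain f where f: "continuous_map ?T euclideanreal f" "f x = 0" "f ` {y} \<subseteq> {1}"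
      using xy unfolding completely_regular_space_alt by blast
    then have "f \<in> I" by (simp add: I_def)
    then have "f x = f y" using xy(3) by (metis e_def restrict_apply')
    with f show False by auto
  qed
  ultimately have "embedding_map ?T ?P e"
    using cont injective_closed_imp_embedding_map by blast
  then have "?T homeomorphic_space subtopology ?P (e ` topspace ?T)"
    by (rule embedding_map_imp_homeomorphic_space)
  moreover have "closedin ?P (e ` topspace ?T)"
    using \<open>closed_map ?T ?P e\<close> closedin_topspace unfolding closed_map_def by blast
  ultimately show ?thesis unfolding realcompact_space_def Z_def by blast
qed

text \<open>The set where \<open>q > 0\<close> is one of the realcompact subspaces in the defining
  intersection.\<close>

lemma Hewitt_realcompactification_in_pos:
  assumes SC: "Stone_Cech_compactification X B" and y: "y \<in> Hewitt_realcompactification_in B X"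
    and q: "continuous_map B euclideanreal q" and pos: "\<And>x. x \<in> topspace X \<Longrightarrow> q x > 0"
  shows "q y > 0"
proof -
  have B: "compact_space B" "Hausdorff_space B" "topspace X \<subseteq> topspace B"
    using SC by (auto simp: Stone_Cech_compactification_def)
  let ?Z = "{b \<in> topspace B. q b > 0}"
  have "realcompact_space (subtopology B ?Z)" using realcompact_space_cozero[OF B(1,2) q] .
  moreover have "topspace X \<subseteq> ?Z" using B(3) pos by auto
  ultimately have "y \<in> ?Z"
    using y unfolding Hewitt_realcompactification_in_def by blast
  then show ?thesis by simp
qed

text \<open>If the extension of \<open>h x = sup\<^sub>n min 1 \<bar>f\<^sub>n x - f\<^sub>n y\<bar>\<close> had a value \<open>c > 0\<close> at \<open>y\<close>, then, with
  \<open>h\<^sub>0\<close> the analogous supremum with weights \<open>2\<^sup>-\<^sup>n\<close>, the function \<open>h\<^sub>0 + max 0 (c - h)\<close> would be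
  positive on \<open>X\<close> and vanish at \<open>y\<close>.\<close>

lemma Hewitt_realcompactification_in_small_oscillation:
  assumes SC: "Stone_Cech_compactification X B"
    and K: "equicontinuous_family X K" "countable K"
    and y: "y \<in> Y" "y \<in> topspace B" "y \<in> Hewitt_realcompactification_in B X"
    and XY: "topspace X \<subseteq> Y"
    and contK: "\<And>f. f \<in> K \<Longrightarrow> continuous_map (subtopology B Y) euclideanreal f"
  shows "y \<in> small_oscillation_points B (topspace X) K"
proof (cases "K = {}")
  case True
  then show ?thesis using y by (auto simp: small_oscillation_points_def)
next
  case ne: False
  have dense: "B closure_of topspace X = topspace B"
    using SC by (auto simp: Stone_Cech_compactification_def)
  \<comment> \<open>Positive weights tending to 0 along an enumeration of the countable
    \<open>K\<close>.\<close>
  define w where "w = (\<lambda>f. (1/2::real) ^ to_nat_on K f)"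
  have w: "0 \<le> w f \<and> w f \<le> 1" for f by (simp add: w_def power_le_one)
  have w1: "0 \<le> (1::real) \<and> (1::real) \<le> 1" by simp
  obtain h where h: "continuous_map B euclideanreal h"
      "\<forall>x\<in>topspace X. h x = (SUP f\<in>K. 1 * min 1 \<bar>f x - f y\<bar>)"
    using Stone_Cech_extension_SUP_truncated_distance[where w = "\<lambda>_. 1", OF SC K(1) ne w1, where c = "\<lambda>f. f y"]
    by (elim exE conjE)
  obtain h0 where h0: "continuous_map B euclideanreal h0"
      "\<forall>x\<in>topspace X. h0 x = (SUP f\<in>K. w f * min 1 \<bar>f x - f y\<bar>)"
    using Stone_Cech_extension_SUP_truncated_distance[where w = w, OF SC K(1) ne w, where c = "\<lambda>f. f y"]
    by (elim exE conjE)
  have h0y: "h0 y \<le> 0"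
  proof (rule field_le_epsilon)
    fix \<epsilon> :: real assume e: "\<epsilon> > 0"
    \<comment> \<open>Members of index at least \<open>m\<close> contribute at most
      \<open>\<epsilon>\<close> because of their weights; the finitely many others, collected in
      \<open>F\<close>, are controlled by their continuity at \<open>y\<close>.\<close>
    obtain m where m: "(1/2::real) ^ m < \<epsilon>" using real_arch_pow_inv[OF e, of "1/2"] by auto
    define F where "F = {f \<in> K. to_nat_on K f < m}"
    have "finite F"
    proof (rule inj_on_finite)
      show "inj_on (to_nat_on K) F"
        by (rule inj_on_subset[OF inj_on_to_nat_on[OF K(2)]]) (auto simp: F_def)
      show "to_nat_on K ` F \<subseteq> {..<m}" by (auto simp: F_def)
    qed simp
    \<comment> \<open>An empty \<open>F\<close> would make the indexed intersection the whole type;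
      the factors \<open>Y\<close> and \<open>topspace B\<close> keep \<open>V\<close> inside the
      subspace.\<close>
    define V where "V = (\<Inter>f\<in>F. {x \<in> topspace (subtopology B Y). \<bar>f x - f y\<bar> < \<epsilon>}) \<inter> Y \<inter> topspace B"
    have "openin (subtopology B Y) {x \<in> topspace (subtopology B Y). \<bar>f x - f y\<bar> < \<epsilon>}" if "f \<in> F" for f
      using contK that by (intro continuous_map_real_openin continuous_intros) (auto simp: F_def)
    then have "openin (subtopology B Y) V"
    proof (cases "F = {}")
      case True
      then show ?thesis using openin_topspace[of "subtopology B Y"] by (simp add: V_def Int_commute)
    next
      case False
      then have "V = (\<Inter>f\<in>F. {x \<in> topspace (subtopology B Y). \<bar>f x - f y\<bar> < \<epsilon>})"
        by (auto simp: V_def)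
      then show ?thesis
        using \<open>finite F\<close> False
          \<open>\<And>f. f \<in> F \<Longrightarrow> openin (subtopology B Y) {x \<in> topspace (subtopology B Y). \<bar>f x - f y\<bar> < \<epsilon>}\<close>
        by (simp add: openin_INT2)
    qed
    then obtain U where U: "openin B U" "V = U \<inter> Y" by (auto simp: openin_subtopology)
    have "y \<in> V" using y e by (auto simp: V_def)
    then have "y \<in> U" using U by blast
    have "h0 y \<le> \<epsilon>"
    proof (rule dense_le_on_open[OF h0(1) dense U(1) \<open>y \<in> U\<close>])
      fix x assume x: "x \<in> U \<inter> topspace X"
      then have xV: "x \<in> V" using U XY by blast
      have "(SUP f\<in>K. w f * min 1 \<bar>f x - f y\<bar>) \<le> \<epsilon>"
      proof (rule cSUP_least[OF ne])
        fix f assume f: "f \<in> K"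
        show "w f * min 1 \<bar>f x - f y\<bar> \<le> \<epsilon>"
        proof (cases "f \<in> F")
          case True
          then have "\<bar>f x - f y\<bar> < \<epsilon>" using xV by (auto simp: V_def)
          then have "w f * min 1 \<bar>f x - f y\<bar> \<le> 1 * \<epsilon>"
            using w[of f] e by (intro mult_mono) auto
          then show ?thesis by simp
        next
          case False
          then have "w f \<le> (1/2) ^ m"
            using f by (auto simp: F_def w_def intro: power_decreasing)
          then have "w f * min 1 \<bar>f x - f y\<bar> \<le> \<epsilon> * 1"
            using w[of f] e m by (intro mult_mono) auto
          then show ?thesis by simp
        qed
      qed
      then show "h0 x \<le> \<epsilon>" using h0(2) x by simp
    qed
    then show "h0 y \<le> 0 + \<epsilon>" by simp
  qed
  have hy: "h y \<le> 0"
  proof (rule ccontr)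
    assume c: "\<not> h y \<le> 0"
    define q where "q = (\<lambda>x. h0 x + max 0 (h y - h x))"
    have "continuous_map B euclideanreal q"
      unfolding q_def by (intro continuous_intros h h0)
    moreover have "q x > 0" if x: "x \<in> topspace X" for x
    proof (cases "h0 x > 0")
      case True
      then show ?thesis by (simp add: q_def)
    next
      case False
      \<comment> \<open>Once \<open>h0 x\<close> is not positive, every term of its supremum
        vanishes; as the weights are positive, this gives \<open>f x = f y\<close> for all
        \<open>f\<close>. Then \<open>h x \<le> 0\<close>, and the second summand of
        \<open>q\<close> is positive.\<close>
      have fxy: "f x = f y" if f: "f \<in> K" for f
      proof -
        have "w f * min 1 \<bar>f x - f y\<bar> \<le> 0"
          using SUP_truncated_distance(1)[where w = w, OF ne w f, where x = x and c = "\<lambda>f. f y"]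
            False h0(2)[rule_format, OF x] by simp
        moreover have "w f > 0" by (simp add: w_def)
        ultimately show ?thesis by (auto simp: mult_le_0_iff min_def split: if_splits)
      qed
      have "(SUP f\<in>K. 1 * min 1 \<bar>f x - f y\<bar>) \<le> 0"
      proof (intro cSUP_least[OF ne])
        fix f assume "f \<in> K"
        then show "1 * min 1 \<bar>f x - f y\<bar> \<le> 0"
          using fxy[of f] by simp
      qed
      then have "h x \<le> 0" using h(2)[rule_format, OF x] by simp
      moreover have "h0 x \<ge> 0"
        using SUP_truncated_distance(2)[where w = w, OF ne w, where x = x and c = "\<lambda>f. f y"]
          h0(2)[rule_format, OF x] by simp
      ultimately show ?thesis using c by (simp add: q_def)
    qed
    ultimately have "q y > 0" by (rule Hewitt_realcompactification_in_pos[OF SC y(3)])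
    then show False using h0y by (simp add: q_def)
  qed
  show ?thesis
  proof (rule small_oscillation_pointsI[OF y(2)])
    fix \<delta> :: real assume d: "0 < \<delta>" "\<delta> \<le> 1"
    let ?U = "{x \<in> topspace B. h x < \<delta>}"
    have "openin B ?U" by (rule continuous_map_real_openin[OF h(1)])
    moreover have "y \<in> ?U" using hy d y by auto
    \<comment> \<open>As \<open>\<delta> \<le> 1\<close>, a truncated distance below
      \<open>\<delta>\<close> is the distance itself.\<close>
    moreover have "\<bar>f x - f y\<bar> < \<delta>" if "f \<in> K" "x \<in> ?U \<inter> topspace X" for f x
      using SUP_truncated_distance(1)[where w = "\<lambda>_. 1", OF ne w1 that(1), where x = x and c = "\<lambda>f. f y"]
        that(2) h(2) d by auto
    ultimately show "\<exists>c U. openin B U \<and> y \<in> U \<and> (\<forall>f\<in>K. \<forall>x\<in>U \<inter> topspace X. \<bar>f x - c f\<bar> < \<delta>)"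
      by (intro exI[of _ "\<lambda>f. f y"] exI[of _ ?U]) auto
  qed
qed


section \<open>The compact-open topology and equicontinuity\<close>

text \<open>Members of \<open>Ck X\<close> are cut off outside the carrier, so functions from a
  larger space must be cut off as well; equicontinuity sees only values on the carrier.\<close>

lemma equicontinuous_family_restrict:
  "equicontinuous_family X ((\<lambda>f. restrict f (topspace X)) ` K) \<longleftrightarrow> equicontinuous_family X K"
proof -
  have *: "(\<forall>y\<in>U. \<forall>f\<in>(\<lambda>f. restrict f (topspace X)) ` K. \<bar>f y - f x\<bar> < \<epsilon>) \<longleftrightarrow>
      (\<forall>y\<in>U. \<forall>f\<in>K. \<bar>f y - f x\<bar> < \<epsilon>)" if "openin X U" "x \<in> topspace X" for U x \<epsilon>
  proof -
    have "restrict f (topspace X) y = f y" if "y \<in> U" for f :: "'a \<Rightarrow> real" and y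
      using openin_subset[OF \<open>openin X U\<close>] that by auto
    then show ?thesis using that(2) by simp
  qed
  show ?thesis
    unfolding equicontinuous_family_def
    by (intro ball_cong refl iff_allI imp_cong iff_exI conj_cong *)
qed

text \<open>A compact subset of \<open>X\<close> is compact in \<open>T\<close>, so a subbasic open
  set of \<open>Ck X\<close> pulls back to the one of \<open>Ck T\<close> with the same
  \<open>K\<close> and \<open>U\<close>.\<close>

lemma continuous_map_Ck_restrict:
  assumes "X = subtopology T S" "S \<subseteq> topspace T"
  shows "continuous_map (Ck T) (Ck X) (\<lambda>f. restrict f S)"
proof -
  have tX: "topspace X = S" using assms by auto
  have mem: "restrict f S \<in> cont_real_functions X" if "f \<in> cont_real_functions T" for f
  proof -
    have "continuous_map X euclideanreal f"
      using that assms by (simp add: cont_real_functions_def continuous_map_from_subtopology)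
    then have "continuous_map X euclideanreal (restrict f S)"
      by (rule continuous_map_eq) (simp add: tX)
    then show ?thesis by (simp add: cont_real_functions_def tX)
  qed
  show ?thesis
    unfolding Ck_def[of X]
  proof (rule continuous_on_generated_topo)
    fix V assume "V \<in> {{f \<in> cont_real_functions X. f ` K \<subseteq> U} |K U. compactin X K \<and> open U}"
    then obtain K U where V: "V = {f \<in> cont_real_functions X. f ` K \<subseteq> U}" "compactin X K" "open U"
      by blast
    then have K: "K \<subseteq> S" "compactin T K"
      using tX compactin_subset_topspace assms by (auto simp: compactin_subtopology)
    have "(\<lambda>f. restrict f S) -` V \<inter> topspace (Ck T) = {f \<in> cont_real_functions T. f ` K \<subseteq> U}"
      using mem K(1) by (auto simp: V topspace_Ck subset_iff image_subset_iff)
    moreover have "openin (Ck T) {f \<in> cont_real_functions T. f ` K \<subseteq> U}"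
      unfolding Ck_def by (rule topology_generated_by_Basis) (use K V in blast)
    ultimately show "openin (Ck T) ((\<lambda>f. restrict f S) -` V \<inter> topspace (Ck T))" by simp
  next
    show "(\<lambda>f. restrict f S) ` topspace (Ck T) \<subseteq>
        \<Union> {{f \<in> cont_real_functions X. f ` K \<subseteq> U} |K U. compactin X K \<and> open U}"
      using mem topspace_Ck[of T] topspace_Ck[of X]
      unfolding Ck_def[of X] topology_generated_by_topspace by blast
  qed
qed

text \<open>The tube lemma: compactness of \<open>K\<close> merges the joint neighbourhoods of the
  points \<open>(x, f)\<close> into one neighbourhood of \<open>x\<close> serving all
  \<open>f\<close>.\<close>

lemma evenly_continuous_imp_equicontinuous:
  assumes K: "compactin (Ck X) K" and ev: "evenly_continuous X K"
  shows "equicontinuous_family X K"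
  unfolding equicontinuous_family_def
proof (intro ballI allI impI)
  fix x and \<epsilon> :: real assume x: "x \<in> topspace X" and e: "\<epsilon> > 0"
  let ?T = "subtopology (Ck X) K" and ?P = "prod_topology X (subtopology (Ck X) K)"
  have Ks: "topspace ?T = K" using compactin_subset_topspace[OF K] by auto
  have c1: "continuous_map ?P euclideanreal (\<lambda>p. snd p (fst p))"
    using ev by (simp add: evenly_continuous_def case_prod_unfold)
  \<comment> \<open>Evaluation at the fixed point \<open>x\<close> is joint evaluation after
    \<open>(x', f) \<mapsto> (x, f)\<close>.\<close>
  have "continuous_map ?P euclideanreal ((\<lambda>p. snd p (fst p)) \<circ> (\<lambda>p. (x, snd p)))"
    by (rule continuous_map_compose[OF _ c1])
      (use x in \<open>auto simp: continuous_map_pairwise o_def continuous_map_snd\<close>)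
  then have "continuous_map ?P euclideanreal (\<lambda>p. \<bar>snd p (fst p) - snd p x\<bar>)"
    using c1 by (intro continuous_intros) (auto simp: o_def)
  then have W: "openin ?P {p \<in> topspace ?P. \<bar>snd p (fst p) - snd p x\<bar> < \<epsilon>}" (is "openin _ ?W")
    by (rule continuous_map_real_openin)
  have cK: "compactin ?T K" using K by (simp add: compactin_subtopology)
  have sub: "{x} \<times> K \<subseteq> ?W" using x e Ks by auto
  from tube_lemma_right[OF W cK x sub]
  obtain U V where U: "openin X U" "x \<in> U" and V: "K \<subseteq> V" "U \<times> V \<subseteq> ?W"
    by (elim exE conjE)
  have "\<bar>f x' - f x\<bar> < \<epsilon>" if "x' \<in> U" "f \<in> K" for x' f
  proof -
    have "(x', f) \<in> ?W" using V that by blast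
    then show ?thesis by simp
  qed
  with U show "\<exists>U. openin X U \<and> x \<in> U \<and> (\<forall>x'\<in>U. \<forall>f\<in>K. \<bar>f x' - f x\<bar> < \<epsilon>)" by blast
qed

text \<open>Equicontinuity absorbs the change of the point uniformly in \<open>g\<close>; the
  subbasic set for the compact singleton \<open>{x}\<close> absorbs the change of the
  function.\<close>

lemma equicontinuous_imp_evenly_continuous:
  assumes K: "K \<subseteq> topspace (Ck X)" and eq: "equicontinuous_family X K"
  shows "evenly_continuous X K"
  unfolding evenly_continuous_def continuous_map_real_iff
proof (intro ballI allI impI)
  let ?T = "subtopology (Ck X) K"
  fix p and \<epsilon> :: real assume p: "p \<in> topspace (prod_topology X ?T)" and e: "\<epsilon> > 0"
  obtain x f where xf: "p = (x, f)" "x \<in> topspace X" "f \<in> K" using p by auto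
  obtain U where U: "openin X U" "x \<in> U" "\<forall>y\<in>U. \<forall>g\<in>K. \<bar>g y - g x\<bar> < \<epsilon>/2"
    using equicontinuous_familyD[OF eq xf(2), of "\<epsilon>/2"] e by auto
  let ?V = "{g \<in> cont_real_functions X. g ` {x} \<subseteq> ball (f x) (\<epsilon>/2)}"
  have "openin (Ck X) ?V"
    unfolding Ck_def
  proof (rule topology_generated_by_Basis)
    have "compactin X {x}" using xf by simp
    then show "?V \<in> {{f \<in> cont_real_functions X. f ` K \<subseteq> U} |K U. compactin X K \<and> open U}"
      using open_ball by blast
  qed
  then have "openin ?T (?V \<inter> K)" by (auto simp: openin_subtopology)
  then have "openin (prod_topology X ?T) (U \<times> (?V \<inter> K))"
    using U by (simp add: openin_prod_Times_iff)
  moreover have "p \<in> U \<times> (?V \<inter> K)" using U xf K e by (auto simp: topspace_Ck)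
  moreover have "\<bar>(case p' of (x, f) \<Rightarrow> f x) - (case p of (x, f) \<Rightarrow> f x)\<bar> < \<epsilon>"
    if "p' \<in> U \<times> (?V \<inter> K)" for p'
  proof -
    obtain y g where yg: "p' = (y, g)" by (cases p')
    then have "y \<in> U" "g \<in> K" and d: "\<bar>f x - g x\<bar> < \<epsilon>/2"
      using that by (auto simp: dist_real_def)
    then have "\<bar>g y - g x\<bar> < \<epsilon>/2" using U(3) by blast
    with d show ?thesis unfolding yg xf(1) prod.case by linarith
  qed
  ultimately show "\<exists>U. openin (prod_topology X ?T) U \<and> p \<in> U \<and>
      (\<forall>y\<in>U. \<bar>(case y of (x, f) \<Rightarrow> f x) - (case p of (x, f) \<Rightarrow> f x)\<bar> < \<epsilon>)"
    by (intro exI[of _ "U \<times> (?V \<inter> K)"] conjI ballI)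
qed


section \<open>Dieudonne completeness of the set of points of small oscillation\<close>

text \<open>A Cauchy filter \<open>F\<close> has a cluster point \<open>b\<close> in \<open>B\<close>, and some \<open>x\<^sub>0 \<in> X\<close> is uniformly close to a
  member of \<open>F\<close>. The extension to \<open>B\<close> of \<open>x \<mapsto> sup\<^sub>f min 1 \<bar>f x - f x\<^sub>0\<bar>\<close> is small on that member,
  hence at \<open>b\<close>, hence on a whole neighbourhood of \<open>b\<close>; so \<open>b\<close> is again a point of small oscillation.\<close>

lemma Dieudonne_complete_small_oscillation_points:
  assumes SC: "Stone_Cech_compactification X B"
    and K: "equicontinuous_family X K" "K \<noteq> {}"
  shows "Dieudonne_complete_space (subtopology B (small_oscillation_points B (topspace X) K))"
proof -
  let ?S = "topspace X"
  define Z where "Z = small_oscillation_points B ?S K"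
  let ?T = "subtopology B Z"
  have B: "compact_space B" "Hausdorff_space B" and dense: "B closure_of ?S = topspace B"
    using SC by (auto simp: Stone_Cech_compactification_def)
  have ZB: "Z \<subseteq> topspace B" by (auto simp: Z_def small_oscillation_points_def)
  then have topT: "topspace ?T = Z" by auto
  have meets: "\<exists>x. x \<in> U \<inter> ?S" if "openin B U" "z \<in> U" for U z
    using dense that unfolding dense_intersects_open by blast
  have cr: "completely_regular_space ?T"
    using B by (simp add: completely_regular_space_subtopology normal_imp_completely_regular_space
        compact_Hausdorff_or_regular_imp_normal_space)
  then have tych: "Tychonoff_space ?T"
    using B by (simp add: Tychonoff_space_def Hausdorff_space_subtopology)

  define near where "near = (\<lambda>\<epsilon> U V. \<forall>f\<in>K. \<forall>x\<in>U \<inter> ?S. \<forall>x'\<in>V \<inter> ?S. \<bar>f x - f x'\<bar> < \<epsilon>)"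
  define R where "R = (\<lambda>\<epsilon>. {(z, z'). z \<in> Z \<and> z' \<in> Z \<and>
    (\<exists>U V. openin B U \<and> openin B V \<and> z \<in> U \<and> z' \<in> V \<and> near \<epsilon> U V)})"
  have osc: "\<exists>U. openin B U \<and> z \<in> U \<and> near \<epsilon> U U" if "z \<in> Z" "\<epsilon> > 0" for z \<epsilon>
    using small_oscillation_pointsD[OF that[unfolded Z_def]] by (simp add: near_def)
  obtain \<V> where V: "continuous_uniformity ?T \<V>" "\<And>\<epsilon>. \<epsilon> > 0 \<Longrightarrow> eventually (\<lambda>p. p \<in> R \<epsilon>) \<V>"
  proof (rule continuous_uniformity_of_scale[of R ?T])
    fix \<epsilon> :: real assume "\<epsilon> > 0"
    show "R \<epsilon> \<subseteq> topspace ?T \<times> topspace ?T" unfolding topT R_def by blast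
  next
    fix \<epsilon> :: real and x y assume "\<epsilon> > 0" "(x, y) \<in> R \<epsilon>"
    then obtain U V where UV: "x \<in> Z" "y \<in> Z" "openin B U" "openin B V" "x \<in> U" "y \<in> V" "near \<epsilon> U V"
      by (auto simp: R_def)
    have "near \<epsilon> V U"
      unfolding near_def
    proof (intro ballI)
      fix f a b assume "f \<in> K" "a \<in> V \<inter> ?S" "b \<in> U \<inter> ?S"
      then have "\<bar>f b - f a\<bar> < \<epsilon>" using UV(7) unfolding near_def by blast
      then show "\<bar>f a - f b\<bar> < \<epsilon>" by linarith
    qed
    with UV show "(y, x) \<in> R \<epsilon>" by (auto simp: R_def)
  next
    fix \<epsilon> :: real and x y z assume "\<epsilon> > 0" and xy: "(x, y) \<in> R (\<epsilon>/2)" and yz: "(y, z) \<in> R (\<epsilon>/2)"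
    obtain U V where UV: "x \<in> Z" "openin B U" "openin B V" "x \<in> U" "y \<in> V" "near (\<epsilon>/2) U V"
      using xy by (auto simp: R_def)
    obtain V' W where VW: "z \<in> Z" "openin B V'" "openin B W" "y \<in> V'" "z \<in> W" "near (\<epsilon>/2) V' W"
      using yz by (auto simp: R_def)
    \<comment> \<open>The two neighbourhoods of the middle point \<open>y\<close> may differ;
      density supplies a common point of \<open>X\<close> for the triangle inequality.\<close>
    obtain v where v: "v \<in> (V \<inter> V') \<inter> ?S"
      using meets[of "V \<inter> V'" y] UV VW by blast
    have "\<bar>f x' - f z'\<bar> < \<epsilon>" if "f \<in> K" "x' \<in> U \<inter> ?S" "z' \<in> W \<inter> ?S" for f x' z'
    proof -
      have "\<bar>f x' - f v\<bar> < \<epsilon>/2" "\<bar>f v - f z'\<bar> < \<epsilon>/2"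
        using UV(6) VW(6) v that unfolding near_def by blast+
      then show ?thesis by linarith
    qed
    then have "near \<epsilon> U W" by (simp add: near_def)
    with UV VW show "(x, z) \<in> R \<epsilon>" by (auto simp: R_def)
  next
    fix \<delta> \<epsilon> :: real assume "0 < \<delta>" "\<delta> \<le> \<epsilon>"
    have "near \<epsilon> U V" if "near \<delta> U V" for U V
      unfolding near_def
    proof (intro ballI)
      fix f a b assume "f \<in> K" "a \<in> U \<inter> ?S" "b \<in> V \<inter> ?S"
      then have "\<bar>f a - f b\<bar> < \<delta>" using that unfolding near_def by blast
      then show "\<bar>f a - f b\<bar> < \<epsilon>" using \<open>\<delta> \<le> \<epsilon>\<close> by linarith
    qed
    then show "R \<delta> \<subseteq> R \<epsilon>" unfolding R_def by blast
  next
    fix \<epsilon> :: real and x assume "\<epsilon> > 0" and x: "x \<in> topspace ?T"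
    then obtain U where U: "openin B U" "x \<in> U" "near \<epsilon> U U" using osc[of x \<epsilon>] topT by auto
    have "openin ?T (U \<inter> Z)" "x \<in> U \<inter> Z" using U x by (auto simp: openin_subtopology)
    moreover have "(x, y) \<in> R \<epsilon>" if "y \<in> U \<inter> Z" for y
      using U x that topT unfolding R_def by blast
    ultimately show "\<exists>U. openin ?T U \<and> x \<in> U \<and> (\<forall>y\<in>U. (x, y) \<in> R \<epsilon>)" by blast
  qed (rule that)

  obtain \<U> where U: "finest_uniformity ?T \<U>" and fine: "\<And>\<V>. continuous_uniformity ?T \<V> \<Longrightarrow> \<U> \<le> \<V>"
    by (rule completely_regular_imp_finest_uniformity[OF cr]) (rule that)
  have "complete_wrt ?T \<U>"
    unfolding complete_wrt_def
  proof (intro allI impI, elim conjE)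
    fix F assume F: "F \<noteq> bot" "F \<le> principal (topspace ?T)" "F \<times>\<^sub>F F \<le> \<U>"
    have "F \<le> principal (topspace B)" using F(2) ZB topT by (auto simp: le_principal elim: eventually_mono)
    from compact_space_imp_cluster_point[OF B(1) F(1) this]
    obtain b where b: "b \<in> topspace B" "\<And>W. openin B W \<Longrightarrow> b \<in> W \<Longrightarrow> frequently (\<lambda>x. x \<in> W) F"
      by auto
    have "b \<in> Z"
      unfolding Z_def
    proof (rule small_oscillation_pointsI[OF b(1)])
      fix \<delta> :: real assume d: "0 < \<delta>" "\<delta> \<le> 1"
      let ?e = "\<delta>/3"
      \<comment> \<open>Here \<open>\<V>\<close> is known to be continuous but not to be compatible,
        so minimality of \<open>\<U>\<close> among all continuous uniformities is used.\<close>
      have "F \<times>\<^sub>F F \<le> \<V>" using F(3) fine[OF V(1)] by (rule order_trans)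
      moreover have "eventually (\<lambda>p. p \<in> R ?e) \<V>" using V(2) d by simp
      ultimately have "eventually (\<lambda>p. p \<in> R ?e) (F \<times>\<^sub>F F)" by (rule filter_leD)
      then obtain Q where Q: "eventually Q F" "\<And>x y. Q x \<Longrightarrow> Q y \<Longrightarrow> (x, y) \<in> R ?e"
        unfolding eventually_prod_same by blast
      obtain a where a: "Q a" using eventually_happens'[OF F(1) Q(1)] by blast
      then have "a \<in> Z" using Q(2)[OF a a] by (simp add: R_def)
      then obtain Ua where Ua: "openin B Ua" "a \<in> Ua" "near ?e Ua Ua" 
        using osc[of a ?e] d by auto
      obtain x0 where x0: "x0 \<in> Ua \<inter> ?S" using meets[OF Ua(1,2)] by blast
      have w: "0 \<le> (1::real) \<and> (1::real) \<le> 1" by simp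
      obtain g where g: "continuous_map B euclideanreal g"
          "\<forall>x\<in>?S. g x = (SUP f\<in>K. 1 * min 1 \<bar>f x - f x0\<bar>)"
        using Stone_Cech_extension_SUP_truncated_distance[where w = "\<lambda>_. 1" and c = "\<lambda>f. f x0", OF SC K w]
        by (elim exE conjE)
      \<comment> \<open>One \<open>?e\<close> leads from points of \<open>X\<close> near
        \<open>z\<close> to a point \<open>v\<close> near \<open>a\<close>, another from
        \<open>v\<close> to \<open>x0\<close> inside \<open>Ua\<close>. Being a third of
        \<open>\<delta>\<close>, \<open>?e\<close> leaves room for a strict bound at
        \<open>b\<close>.\<close>
      have gQ: "g z \<le> 2 * ?e" if z: "Q z" for z
      proof -
        obtain U V where UV: "openin B U" "openin B V" "z \<in> U" "a \<in> V" "near ?e U V"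
          using Q(2)[OF z a] by (auto simp: R_def)
        obtain v where v: "v \<in> (V \<inter> Ua) \<inter> ?S" using meets[of "V \<inter> Ua" a] UV Ua by blast
        show ?thesis
        proof (rule dense_le_on_open[OF g(1) dense UV(1,3)])
          fix x assume x: "x \<in> U \<inter> ?S"
          have "(SUP f\<in>K. 1 * min 1 \<bar>f x - f x0\<bar>) \<le> 2 * ?e"
          proof (rule cSUP_least[OF K(2)])
            fix f assume f: "f \<in> K"
            have "\<bar>f x - f v\<bar> < ?e" "\<bar>f v - f x0\<bar> < ?e"
              using UV(5) Ua(3) v x x0 f unfolding near_def by blast+
            then have "\<bar>f x - f x0\<bar> \<le> 2 * ?e" by linarith
            then show "1 * min 1 \<bar>f x - f x0\<bar> \<le> 2 * ?e"
              unfolding mult_1_left by (rule min.coboundedI2)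
          qed
          then show "g x \<le> 2 * ?e" using g(2) x by simp
        qed
      qed
      let ?W = "{x \<in> topspace B. g x < \<delta>}"
      have "g b \<le> 2 * ?e"
      proof (rule ccontr)
        assume "\<not> g b \<le> 2 * ?e"
        then have "b \<in> {x \<in> topspace B. g x > 2 * ?e}" using b(1) by simp
        with continuous_map_real_openin(2)[OF g(1)]
        have "frequently (\<lambda>x. x \<in> {x \<in> topspace B. g x > 2 * ?e}) F" by (rule b(2))
        then have "frequently (\<lambda>x. x \<in> {x \<in> topspace B. g x > 2 * ?e} \<and> Q x) F"
          using Q(1) by (rule frequently_eventually_frequently)
        then obtain x where "g x > 2 * ?e" "Q x" by (auto dest: frequently_ex)
        with gQ[of x] show False by simp
      qed
      then have "b \<in> ?W" using b(1) d by simp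
      moreover have "openin B ?W" by (rule continuous_map_real_openin[OF g(1)])
      moreover have "\<bar>f x - f x0\<bar> < \<delta>" if "f \<in> K" "x \<in> ?W \<inter> ?S" for f x
        using SUP_truncated_distance(1)[where w = "\<lambda>_. 1", OF K(2) w that(1), where x = x and c = "\<lambda>f. f x0"]
          that(2) g(2) d by auto
      ultimately show "\<exists>c U. openin B U \<and> b \<in> U \<and> (\<forall>f\<in>K. \<forall>x\<in>U \<inter> ?S. \<bar>f x - c f\<bar> < \<delta>)"
        by (intro exI[of _ "\<lambda>f. f x0"] exI[of _ ?W]) auto
    qed
    moreover have "F \<le> nhdsin ?T b"
    proof (rule Cauchy_filter_le_nhdsin[OF _ _ F(3)])
      show "compatible_uniformity ?T \<U>" using U by (simp add: finest_uniformity_def)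
      show "b \<in> topspace ?T" using \<open>b \<in> Z\<close> topT by simp
      fix W assume "openin ?T W" "b \<in> W"
      then obtain W' where W': "openin B W'" "W = W' \<inter> Z" by (auto simp: openin_subtopology)
      then have "frequently (\<lambda>x. x \<in> W') F" using b(2) \<open>b \<in> W\<close> by blast
      moreover have "eventually (\<lambda>x. x \<in> Z) F" using F(2) unfolding topT le_principal .
      ultimately have "frequently (\<lambda>x. x \<in> W' \<and> x \<in> Z) F" by (rule frequently_eventually_frequently)
      then show "frequently (\<lambda>x. x \<in> W) F" using W' by simp
    qed
    ultimately show "\<exists>x\<in>topspace ?T. F \<le> nhdsin ?T x" using topT by blast
  qed
  then show ?thesis using tych U unfolding Dieudonne_complete_space_def Z_def by blast
qed

text \<open>With reference values \<open>f x\<close>, equicontinuity puts each \<open>x\<close> of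
  \<open>X\<close> into the set of points of small oscillation, which is then one of the Dieudonne
  complete subspaces in the defining intersection.\<close>

lemma Dieudonne_completion_in_small_oscillation:
  assumes SC: "Stone_Cech_compactification X B" and K: "equicontinuous_family X K"
    and Y: "Y \<subseteq> Dieudonne_completion_in B X" "Y \<subseteq> topspace B"
  shows "Y \<subseteq> small_oscillation_points B (topspace X) K"
proof (cases "K = {}")
  case True
  then show ?thesis using Y(2) by (auto simp: small_oscillation_points_def)
next
  case False
  let ?Z = "small_oscillation_points B (topspace X) K"
  have X: "X = subtopology B (topspace X)" "topspace X \<subseteq> topspace B"
    using SC by (auto simp: Stone_Cech_compactification_def)
  have "x \<in> ?Z" if x: "x \<in> topspace X" for x
  proof (rule small_oscillation_pointsI)
    show "x \<in> topspace B" using x X(2) by blast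
    fix \<delta> :: real assume "0 < \<delta>"
    then obtain U where U: "openin X U" "x \<in> U" "\<forall>y\<in>U. \<forall>f\<in>K. \<bar>f y - f x\<bar> < \<delta>"
      using equicontinuous_familyD[OF K x, of \<delta>] by auto
    obtain U' where "openin B U'" "U = U' \<inter> topspace X"
      using U(1) X(1) by (metis openin_subtopology)
    with U show "\<exists>c U. openin B U \<and> x \<in> U \<and> (\<forall>f\<in>K. \<forall>y\<in>U \<inter> topspace X. \<bar>f y - c f\<bar> < \<delta>)"
      by (intro exI[of _ "\<lambda>f. f x"] exI[of _ U']) auto
  qed
  then have "?Z \<in> {Z. topspace X \<subseteq> Z \<and> Z \<subseteq> topspace B \<and> Dieudonne_complete_space (subtopology B Z)}"
    using Dieudonne_complete_small_oscillation_points[OF SC K False]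
    by (auto simp: small_oscillation_points_def)
  then show ?thesis using Y(1) unfolding Dieudonne_completion_in_def by blast
qed


section \<open>Ascoli extensions\<close>

lemma dense_intermediate_subspace:
  assumes B: "compact_space B" "Hausdorff_space B" "B closure_of topspace X = topspace B"
      "X = subtopology B (topspace X)"
    and Y: "topspace X \<subseteq> Y" "Y \<subseteq> topspace B"
  shows "Tychonoff_space (subtopology B Y)"
    and "subtopology B Y closure_of topspace X = topspace (subtopology B Y)"
    and "X = subtopology (subtopology B Y) (topspace X)"
    and "topspace X \<subseteq> topspace (subtopology B Y)"
proof -
  show "Tychonoff_space (subtopology B Y)"
    using B by (simp add: Tychonoff_space_def Hausdorff_space_subtopology
        completely_regular_space_subtopology normal_imp_completely_regular_space
        compact_Hausdorff_or_regular_imp_normal_space)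
  show "subtopology B Y closure_of topspace X = topspace (subtopology B Y)"
    using B(3) Y by (auto simp: closure_of_subtopology Int_absorb1)
  show "X = subtopology (subtopology B Y) (topspace X)"
    using B(4) Y(1) by (simp add: subtopology_subtopology Int_absorb1)
  show "topspace X \<subseteq> topspace (subtopology B Y)" using Y by auto
qed

theorem theorem3p9:
  fixes X B :: "'a topology" and Y :: "'a set"
  assumes "Tychonoff_space X"
    and "Stone_Cech_compactification X B"
    and "topspace X \<subseteq> Y" and "Y \<subseteq> topspace B"
  shows "(Ascoli_space X \<and> Y \<subseteq> Dieudonne_completion_in B X
            \<longrightarrow> Ascoli_space (subtopology B Y)) \<and>
         (sequentially_Ascoli_space X \<and> Y \<subseteq> Hewitt_realcompactification_in B X
            \<longrightarrow> sequentially_Ascoli_space (subtopology B Y))"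
proof -
  let ?T = "subtopology B Y" and ?S = "topspace X"
  let ?r = "\<lambda>f :: 'a \<Rightarrow> real. restrict f ?S"
  have B: "compact_space B" "Hausdorff_space B" "B closure_of ?S = topspace B"
      "X = subtopology B ?S"
    using assms(2) by (auto simp: Stone_Cech_compactification_def)
  note T = dense_intermediate_subspace[OF B assms(3,4)]
  have r: "continuous_map (Ck ?T) (Ck X) ?r" by (rule continuous_map_Ck_restrict[OF T(3,4)])
  have topT: "topspace ?T = Y" using assms(4) by auto
  have cont: "continuous_map ?T euclideanreal f" if "f \<in> topspace (Ck ?T)" for f
    using that by (simp add: topspace_Ck cont_real_functions_def)
  show ?thesis
  proof (intro conjI impI)
    assume *: "Ascoli_space X \<and> Y \<subseteq> Dieudonne_completion_in B X"
    have "evenly_continuous ?T K" if K: "compactin (Ck ?T) K" for K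
    proof (rule equicontinuous_imp_evenly_continuous)
      show KC: "K \<subseteq> topspace (Ck ?T)" using K by (rule compactin_subset_topspace)
      \<comment> \<open>The Ascoli property of \<open>X\<close> speaks about \<open>Ck X\<close>, so
        \<open>K\<close> is moved there by the continuous restriction map; equicontinuity on
        \<open>X\<close> is unaffected by the cut-off.\<close>
      have c: "compactin (Ck X) (?r ` K)" using K r by (rule image_compactin)
      then have "evenly_continuous X (?r ` K)" using * by (simp add: Ascoli_space_def)
      then have "equicontinuous_family X K"
        using evenly_continuous_imp_equicontinuous[OF c] equicontinuous_family_restrict by blast
      then have "Y \<subseteq> small_oscillation_points B ?S K"
        using Dieudonne_completion_in_small_oscillation[OF assms(2)] * assms(4) by blast
      then show "equicontinuous_family ?T K"
        using KC cont topT by (intro small_oscillation_imp_equicontinuous[OF _ T(2)]) auto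
    qed
    with T(1) show "Ascoli_space ?T" by (simp add: Ascoli_space_def)
  next
    assume *: "sequentially_Ascoli_space X \<and> Y \<subseteq> Hewitt_realcompactification_in B X"
    have "equicontinuous_family ?T (range f)"
      if f: "range f \<subseteq> topspace (Ck ?T)" and l: "limitin (Ck ?T) f l sequentially"
      for f :: "nat \<Rightarrow> 'a \<Rightarrow> real" and l
    proof -
      have "limitin (Ck X) (?r \<circ> f) (?r l) sequentially" using r l by (rule continuous_map_limit)
      moreover have "range (?r \<circ> f) \<subseteq> topspace (Ck X)"
        using r f by (auto simp: continuous_map_def)
      ultimately have "equicontinuous_family X (range (?r \<circ> f))"
        using * unfolding sequentially_Ascoli_space_def by blast
      then have "equicontinuous_family X (range f)"
        using equicontinuous_family_restrict[of X "range f"] by (simp add: image_comp)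
      \<comment> \<open>The range of a sequence is countable, which is what admits points of the
        realcompactification.\<close>
      then have "Y \<subseteq> small_oscillation_points B ?S (range f)"
        using Hewitt_realcompactification_in_small_oscillation[OF assms(2), of "range f" _ Y]
          * assms(3,4) f cont by blast
      then show ?thesis
        using f cont topT by (intro small_oscillation_imp_equicontinuous[OF _ T(2)]) auto
    qed
    with T(1) show "sequentially_Ascoli_space ?T" unfolding sequentially_Ascoli_space_def by blast
  qed
qed

end
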